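(* Let $\Omega\subset\mathbb{R}^N$ be a bounded domain with smooth boundary, let $p,q>1$ and let $\alpha,\beta\ge1$ be real numbers satisfying $\frac{\alpha}{p}+\frac{\beta}{q}=1$. Let $$\lambda(p,q)=\min_{(u,v)\in\mathcal{A}}\frac{\frac{\alpha}{p}\int_\Omega|\nabla u|^p\,dx+\frac{\beta}{q}\int_\Omega|\nabla v|^q\,dx}{\int_\Omega|u|^{\alpha-1}|v|^{\beta-1}uv\,dx},$$ where $$\mathcal{A}=\left\{(u,v)\in W^{1,p}_0(\Omega)\times W^{1,q}_0(\Omega):\int_\Omega|u|^{\alpha-1}|v|^{\beta-1}uv\,dx>0\right\}.$$ Then $$\lambda(p,q)\ge\min\{\lambda(p),\lambda(q)\},$$ where $\lambda(p)$ and $\lambda(q)$ are the first eigenvalues of the $p$-Laplacian and the $q$-Laplacian on $\Omega$ with zero Dirichlet boundary conditions.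
   Context: For $r>1$, the first eigenvalue of the $r$-Laplacian $\Delta_r w=\operatorname{div}(|\nabla w|^{r-2}\nabla w)$ in $W^{1,r}_0(\Omega)$ is $$\lambda(r)=\min_{u\in W^{1,r}_0(\Omega),\,u\neq0}\frac{\int_\Omega|\nabla u|^r\,dx}{\int_\Omega|u|^r\,dx}.$$ It is known that the minimum defining $\lambda(p,q)$ is attained; $\lambda(p,q)$ is the first (principal) eigenvalue of the system $-\Delta_p u=\lambda|u|^{\alpha-1}|v|^{\beta-1}v$, $-\Delta_q v=\lambda|u|^{\alpha-1}|v|^{\beta-1}u$ in $\Omega$, $u=v=0$ on $\partial\Omega$. *)

theory Defs
  imports "HOL-Analysis.Analysis"
begin

section \<open>Smooth functions and smooth domains\<close>

primrec C_k :: "nat \<Rightarrow> ('a::euclidean_space \<Rightarrow> real) \<Rightarrow> bool" where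
  "C_k 0 f \<longleftrightarrow> continuous_on UNIV f"
| "C_k (Suc k) f \<longleftrightarrow> (\<forall>x. f differentiable (at x)) \<and>
     (\<forall>i\<in>Basis. C_k k (\<lambda>x. frechet_derivative f (at x) i))"

definition smooth :: "('a::euclidean_space \<Rightarrow> real) \<Rightarrow> bool" where
  "smooth f \<longleftrightarrow> (\<forall>k. C_k k f)"

definition gradient :: "('a::euclidean_space \<Rightarrow> real) \<Rightarrow> 'a \<Rightarrow> 'a" where
  "gradient f x = (\<Sum>i\<in>Basis. frechet_derivative f (at x) i *\<^sub>R i)"

text \<open>Near each boundary point, after relabelling and reorienting the coordinate axes, the set is
  the region strictly above the graph of a smooth function \<open>\<gamma>\<close> of the remaining \<open>N - 1\<close>
  coordinates. Here \<open>e\<close> is the vertical axis; \<open>\<gamma>\<close> is defined on the whole space, but only its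
  values on the hyperplane orthogonal to \<open>e\<close> are used.\<close>

definition smooth_boundary :: "'a::euclidean_space set \<Rightarrow> bool" where
  "smooth_boundary \<Omega> \<longleftrightarrow>
     (\<forall>x\<in>frontier \<Omega>. \<exists>r>0. \<exists>e. (e \<in> Basis \<or> - e \<in> Basis) \<and>
        (\<exists>\<gamma>. smooth \<gamma> \<and>
           \<Omega> \<inter> ball x r = {y \<in> ball x r. y \<bullet> e > \<gamma> (y - (y \<bullet> e) *\<^sub>R e)}))"

definition smooth_bounded_domain :: "'a::euclidean_space set \<Rightarrow> bool" where
  "smooth_bounded_domain \<Omega> \<longleftrightarrow>
     open \<Omega> \<and> connected \<Omega> \<and> \<Omega> \<noteq> {} \<and> bounded \<Omega> \<and> smooth_boundary \<Omega>"


section \<open>Sobolev spaces\<close>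

text \<open>Elements of \<open>L\<^sup>p\<close> and of the Sobolev spaces are represented by functions on the whole type;
  only their values on \<open>\<Omega>\<close> matter, and these only up to null sets.\<close>

definition test_functions :: "'a::euclidean_space set \<Rightarrow> ('a \<Rightarrow> real) set" where
  "test_functions \<Omega> = {\<phi>. smooth \<phi> \<and> compact (closure {x. \<phi> x \<noteq> 0}) \<and> closure {x. \<phi> x \<noteq> 0} \<subseteq> \<Omega>}"

definition Lp_space :: "real \<Rightarrow> 'a::euclidean_space set \<Rightarrow> ('a \<Rightarrow> 'b::euclidean_space) set" where
  "Lp_space p \<Omega> = {f. f \<in> borel_measurable (lebesgue_on \<Omega>) \<and>
     integrable (lebesgue_on \<Omega>) (\<lambda>x. norm (f x) powr p)}"

definition Lp_norm :: "real \<Rightarrow> 'a::euclidean_space set \<Rightarrow> ('a \<Rightarrow> 'b::euclidean_space) \<Rightarrow> real" where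
  "Lp_norm p \<Omega> f = (LINT x|lebesgue_on \<Omega>. norm (f x) powr p) powr (1 / p)"

definition locally_integrable :: "'a::euclidean_space set \<Rightarrow> ('a \<Rightarrow> 'b::euclidean_space) \<Rightarrow> bool" where
  "locally_integrable \<Omega> f \<longleftrightarrow> (\<forall>K. compact K \<and> K \<subseteq> \<Omega> \<longrightarrow> integrable (lebesgue_on K) f)"

definition has_weak_gradient ::
    "'a::euclidean_space set \<Rightarrow> ('a \<Rightarrow> real) \<Rightarrow> ('a \<Rightarrow> 'a) \<Rightarrow> bool" where
  "has_weak_gradient \<Omega> u g \<longleftrightarrow> locally_integrable \<Omega> u \<and> locally_integrable \<Omega> g \<and>
     (\<forall>\<phi>\<in>test_functions \<Omega>. \<forall>i\<in>Basis.
        (LINT x|lebesgue_on \<Omega>. u x * (gradient \<phi> x \<bullet> i)) =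
        - (LINT x|lebesgue_on \<Omega>. (g x \<bullet> i) * \<phi> x))"

text \<open>The weak gradient is unique up to null sets, so the choice below does not affect integrals.\<close>

definition weak_gradient :: "'a::euclidean_space set \<Rightarrow> ('a \<Rightarrow> real) \<Rightarrow> 'a \<Rightarrow> 'a" where
  "weak_gradient \<Omega> u = (SOME g. has_weak_gradient \<Omega> u g)"

text \<open>The space \<open>W\<^sup>1\<^sup>,\<^sup>p\<^sub>0(\<Omega>)\<close>: the closure of the test functions in \<open>W\<^sup>1\<^sup>,\<^sup>p(\<Omega>)\<close>. The function
  \<open>g\<close> is the weak gradient of \<open>u\<close>.\<close>

definition W0 :: "real \<Rightarrow> 'a::euclidean_space set \<Rightarrow> ('a \<Rightarrow> real) set" where
  "W0 p \<Omega> = {u \<in> Lp_space p \<Omega>. \<exists>g\<in>Lp_space p \<Omega>. has_weak_gradient \<Omega> u g \<and>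
     (\<exists>\<phi>. (\<forall>n::nat. \<phi> n \<in> test_functions \<Omega>) \<and>
        (\<lambda>n. Lp_norm p \<Omega> (\<lambda>x. \<phi> n x - u x)) \<longlonglongrightarrow> 0 \<and>
        (\<lambda>n. Lp_norm p \<Omega> (\<lambda>x. gradient (\<phi> n) x - g x)) \<longlonglongrightarrow> 0)}"


section \<open>The first eigenvalues\<close>

text \<open>Both eigenvalues are minima of sets of positive reals. As the minima are attained, they
  coincide with the infima used here. The condition \<open>u \<noteq> 0\<close> is understood in the Sobolev space,
  that is, \<open>u\<close> does not vanish almost everywhere.\<close>

definition first_eigenvalue :: "'a::euclidean_space set \<Rightarrow> real \<Rightarrow> real" where
  "first_eigenvalue \<Omega> r = Inf {
     (LINT x|lebesgue_on \<Omega>. norm (weak_gradient \<Omega> u x) powr r) /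
     (LINT x|lebesgue_on \<Omega>. \<bar>u x\<bar> powr r)
     | u. u \<in> W0 r \<Omega> \<and> \<not> (AE x in lebesgue_on \<Omega>. u x = 0)}"

definition coupling ::
    "'a::euclidean_space set \<Rightarrow> real \<Rightarrow> real \<Rightarrow> ('a \<Rightarrow> real) \<Rightarrow> ('a \<Rightarrow> real) \<Rightarrow> real" where
  "coupling \<Omega> \<alpha> \<beta> u v =
     (LINT x|lebesgue_on \<Omega>. \<bar>u x\<bar> powr (\<alpha> - 1) * \<bar>v x\<bar> powr (\<beta> - 1) * u x * v x)"

definition admissible ::
    "'a::euclidean_space set \<Rightarrow> real \<Rightarrow> real \<Rightarrow> real \<Rightarrow> real \<Rightarrow> (('a \<Rightarrow> real) \<times> ('a \<Rightarrow> real)) set" where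
  "admissible \<Omega> \<alpha> \<beta> p q = {(u, v). u \<in> W0 p \<Omega> \<and> v \<in> W0 q \<Omega> \<and> coupling \<Omega> \<alpha> \<beta> u v > 0}"

definition system_eigenvalue ::
    "'a::euclidean_space set \<Rightarrow> real \<Rightarrow> real \<Rightarrow> real \<Rightarrow> real \<Rightarrow> real" where
  "system_eigenvalue \<Omega> \<alpha> \<beta> p q = Inf {
     (\<alpha> / p * (LINT x|lebesgue_on \<Omega>. norm (weak_gradient \<Omega> u x) powr p) +
      \<beta> / q * (LINT x|lebesgue_on \<Omega>. norm (weak_gradient \<Omega> v x) powr q)) /
     coupling \<Omega> \<alpha> \<beta> u v
     | u v. (u, v) \<in> admissible \<Omega> \<alpha> \<beta> p q}"

end

theory Submission
  imports Defs
begin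

text \<open>
  The coupling integrand is at most \<open>|u|\<^sup>\<alpha> |v|\<^sup>\<beta>\<close>, and Young's inequality with the weights
  \<open>\<alpha>/p\<close> and \<open>\<beta>/q\<close>, which sum to one, bounds this by \<open>\<alpha>/p |u|\<^sup>p + \<beta>/q |v|\<^sup>q\<close>.
  If \<open>(u, v)\<close> is admissible, then neither \<open>u\<close> nor \<open>v\<close> vanishes almost everywhere, so both are
  competitors for their own first eigenvalues: \<open>\<lambda>(p)\<close> times the integral of \<open>|u|\<^sup>p\<close> is at most the
  integral of \<open>|\<nabla>u|\<^sup>p\<close>, and likewise for \<open>v\<close> and \<open>q\<close>. With \<open>m\<close> the smaller of \<open>\<lambda>(p)\<close>
  and \<open>\<lambda>(q)\<close>, which is nonnegative, multiplying the integrated Young inequality by \<open>m\<close> gives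
  \<open>m\<close> times the coupling on the left and at most the weighted sum of the two energies on the right.
  Dividing by the positive coupling bounds every quotient of the system from below by \<open>m\<close>; the
  lemmas \<open>coupling_le\<close> and \<open>first_eigenvalue_mult_le\<close> carry this argument.

  The bound on all quotients bounds their infimum only if there is a quotient at all, because the
  infimum of the empty set of reals is an unspecified number. The longer part of the proof
  therefore shows that some pair is admissible (\<open>admissible_nonempty\<close>). The witness is
  \<open>(\<phi>, \<phi>)\<close> for a bump function \<open>\<phi>\<close> of a small ball: its coupling is the integral of
  \<open>|\<phi>|\<close> to the power \<open>\<alpha> + \<beta>\<close>, which is positive. This needs that such a \<open>\<phi>\<close> exists and is
  smooth, and that the classical gradient of a test function is its weak gradient, that is,
  integration by parts. The latter reduces to the fact that a directional derivative of a
  compactly supported function has integral zero.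
\<close>

section \<open>Closure properties of smooth functions\<close>

lemma C_k_SucI:
  assumes "\<And>x. (f has_derivative D x) (at x)"
    and "\<And>i. i \<in> Basis \<Longrightarrow> C_k k (\<lambda>x. D x i)"
  shows "C_k (Suc k) f"
proof -
  have "frechet_derivative f (at x) = D x" for x
    using frechet_derivative_at[OF assms(1)] by simp
  then show ?thesis
    using assms by (auto simp: differentiable_def)
qed

lemma C_k_SucD: "C_k (Suc k) f \<Longrightarrow> C_k k f"
proof (induction k arbitrary: f)
  case 0
  then show ?case
    by (simp add: continuous_at_imp_continuous_on differentiable_imp_continuous_within)
next
  case (Suc k)
  then show ?case by (metis C_k.simps(2))
qed

lemma C_k_const: "C_k k (\<lambda>x. c)"
proof (induction k arbitrary: c)
  case (Suc k)
  show ?case by (rule C_k_SucI[OF has_derivative_const]) (rule Suc)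
qed simp

lemma C_k_add: "C_k k f \<Longrightarrow> C_k k g \<Longrightarrow> C_k k (\<lambda>x. f x + g x)"
proof (induction k arbitrary: f g)
  case (Suc k)
  show ?case
  proof (rule C_k_SucI)
    show "((\<lambda>x. f x + g x) has_derivative
        (\<lambda>h. frechet_derivative f (at x) h + frechet_derivative g (at x) h)) (at x)" for x
      using Suc.prems by (auto intro!: has_derivative_add simp: frechet_derivative_works[symmetric])
  qed (use Suc in auto)
qed (simp add: continuous_on_add)

lemma C_k_mult: "C_k k f \<Longrightarrow> C_k k g \<Longrightarrow> C_k k (\<lambda>x. f x * g x)"
proof (induction k arbitrary: f g)
  case (Suc k)
  show ?case
  proof (rule C_k_SucI)
    show "((\<lambda>x. f x * g x) has_derivative
        (\<lambda>h. f x * frechet_derivative g (at x) h + frechet_derivative f (at x) h * g x)) (at x)" for x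
      using Suc.prems by (auto intro!: has_derivative_mult simp: frechet_derivative_works[symmetric])
    show "C_k k (\<lambda>x. f x * frechet_derivative g (at x) i + frechet_derivative f (at x) i * g x)"
      if "i \<in> Basis" for i
      using Suc.prems Suc.prems[THEN C_k_SucD] that by (intro C_k_add Suc.IH) auto
  qed
qed (simp add: continuous_on_mult)

lemma C_k_affine: "C_k k (\<lambda>x. c + x \<bullet> b)"
proof (cases k)
  case 0
  then show ?thesis by (simp add: continuous_intros)
next
  case (Suc k)
  have "C_k (Suc k) (\<lambda>x. c + x \<bullet> b)"
    by (rule C_k_SucI[where D = "\<lambda>_ h. h \<bullet> b"])
       (auto intro!: derivative_eq_intros C_k_const)
  then show ?thesis by (simp add: Suc)
qed

lemma C_k_quadratic: "C_k k (\<lambda>x. c - (x - a) \<bullet> (x - a))"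
proof (cases k)
  case 0
  then show ?thesis by (simp add: continuous_intros)
next
  case (Suc k)
  have "C_k (Suc k) (\<lambda>x. c - (x - a) \<bullet> (x - a))"
  proof (rule C_k_SucI)
    show "((\<lambda>x. c - (x - a) \<bullet> (x - a)) has_derivative (\<lambda>h. (2 *\<^sub>R a) \<bullet> h + x \<bullet> (- 2 *\<^sub>R h))) (at x)" for x
      by (auto intro!: derivative_eq_intros simp: algebra_simps inner_commute)
  qed (rule C_k_affine)
  then show ?thesis by (simp add: Suc)
qed

section \<open>Bump functions\<close>

text \<open>
  The derivative of \<open>exp (- 1 / t)\<close> produces negative powers of \<open>t\<close>. With such a power built in, the
  family is closed under differentiation up to linear combinations, so that smoothness of all its
  members follows by one induction.
\<close>

definition flat_exp :: "nat \<Rightarrow> real \<Rightarrow> real" where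
  "flat_exp m t = (if t > 0 then exp (- 1 / t) / t ^ m else 0)"

text \<open>From the right, with \<open>s = 1 / t\<close>, this is the decay of \<open>s ^ m / exp s\<close> at infinity.\<close>

lemma flat_exp_tendsto_0: "(flat_exp m \<longlongrightarrow> 0) (at 0)"
proof (rule filterlim_split_at)
  show "(flat_exp m \<longlongrightarrow> 0) (at_left 0)"
  proof (rule tendsto_eventually)
    show "\<forall>\<^sub>F t in at_left 0. flat_exp m t = 0"
      by (auto simp: flat_exp_def eventually_at_filter)
  qed
  have "((\<lambda>t. inverse t ^ m / exp (inverse t)) \<longlongrightarrow> (0::real)) (at_right 0)"
    by (rule filterlim_compose[OF tendsto_power_div_exp_0 filterlim_inverse_at_top_right])
  moreover have "\<forall>\<^sub>F t in at_right 0. inverse t ^ m / exp (inverse t) = flat_exp m t"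
    by (auto simp: flat_exp_def eventually_at_filter exp_minus divide_simps)
  ultimately show "(flat_exp m \<longlongrightarrow> 0) (at_right 0)"
    by (rule Lim_transform_eventually)
qed

lemma flat_exp_has_derivative:
  "(flat_exp m has_real_derivative flat_exp (m + 2) t - m * flat_exp (m + 1) t) (at t)"
proof -
  consider "t > 0" | "t = 0" | "t < 0" by linarith
  then show ?thesis
  proof cases
    case 1
    have "((\<lambda>t. exp (- 1 / t) / t ^ m) has_real_derivative
        flat_exp (m + 2) t - m * flat_exp (m + 1) t) (at t)"
    proof (cases m)
      case 0
      then show ?thesis
        using 1 by (auto intro!: derivative_eq_intros simp: flat_exp_def power2_eq_square)
    next
      case (Suc n)
      show ?thesis
        unfolding Suc using 1
        by (auto intro!: derivative_eq_intros simp: flat_exp_def simp del: power_Suc)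
           (simp add: field_simps)
    qed
    then show ?thesis
      by (rule has_field_derivative_transform_within_open[where S = "{0<..}"])
         (use 1 in \<open>auto simp: flat_exp_def\<close>)
  next
    case 2
    \<comment> \<open>At the origin the difference quotient is the next member of the family, which tends to zero.\<close>
    have "(\<lambda>h. (flat_exp m (0 + h) - flat_exp m 0) / h) = flat_exp (m + 1)"
      by (auto simp: flat_exp_def fun_eq_iff)
    then show ?thesis
      using flat_exp_tendsto_0[of "m + 1"] 2 by (simp add: DERIV_def) (simp add: flat_exp_def)
  next
    case 3
    have "((\<lambda>t. 0) has_real_derivative 0) (at t)" by simp
    then have "(flat_exp m has_real_derivative 0) (at t)"
      by (rule has_field_derivative_transform_within_open[where S = "{..<0}"])
         (use 3 in \<open>auto simp: flat_exp_def\<close>)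
    then show ?thesis using 3 by (simp add: flat_exp_def)
  qed
qed

text \<open>
  The chain rule expresses a partial derivative of the composition through the compositions with
  \<open>flat_exp (m + 2)\<close> and \<open>flat_exp (m + 1)\<close>; hence the induction on \<open>k\<close> is for all \<open>m\<close> at once.
\<close>

lemma C_k_flat_exp_compose:
  assumes "smooth s"
  shows "C_k k (\<lambda>x. flat_exp m (s x))"
proof (induction k arbitrary: m)
  case 0
  have "continuous_on UNIV (flat_exp m)"
    by (intro continuous_at_imp_continuous_on ballI DERIV_isCont[OF flat_exp_has_derivative])
  moreover have "continuous_on UNIV s"
    using assms C_k.simps(1) smooth_def by blast
  ultimately have "continuous_on UNIV (\<lambda>x. flat_exp m (s x))"
    by (rule continuous_on_compose2) simp
  then show ?case by simp
next
  case (Suc k)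
  have s: "C_k (Suc k) s" using assms smooth_def by blast
  show ?case
  proof (rule C_k_SucI)
    show "((\<lambda>x. flat_exp m (s x)) has_derivative
        (\<lambda>h. (flat_exp (m + 2) (s x) + (- real m) * flat_exp (m + 1) (s x))
          * frechet_derivative s (at x) h)) (at x)" for x
      using has_derivative_compose[of s "frechet_derivative s (at x)" x UNIV "flat_exp m"]
        flat_exp_has_derivative[of m "s x"] s
      by (auto simp: has_field_derivative_def frechet_derivative_works[symmetric])
    show "C_k k (\<lambda>x. (flat_exp (m + 2) (s x) + (- real m) * flat_exp (m + 1) (s x))
          * frechet_derivative s (at x) i)" if "i \<in> Basis" for i
      using s that by (intro C_k_mult C_k_add C_k_const Suc.IH) auto
  qed
qed

text \<open>The polynomial inside \<open>flat_exp 0\<close> is positive exactly on the open ball.\<close>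

lemma test_function_exists:
  fixes \<Omega> :: "'a::euclidean_space set"
  assumes "open \<Omega>" "a \<in> \<Omega>"
  obtains \<phi> r where "\<phi> \<in> test_functions \<Omega>" "r > 0" "ball a r \<subseteq> \<Omega>"
    "\<And>x. x \<in> ball a r \<Longrightarrow> \<phi> x \<noteq> 0"
proof -
  obtain r where r: "r > 0" "cball a r \<subseteq> \<Omega>"
    using assms open_contains_cball by blast
  define \<phi> where "\<phi> x = flat_exp 0 (r\<^sup>2 - (x - a) \<bullet> (x - a))" for x
  have nonzero: "\<phi> x \<noteq> 0 \<longleftrightarrow> x \<in> ball a r" for x
  proof -
    have "\<phi> x \<noteq> 0 \<longleftrightarrow> \<not> r\<^sup>2 \<le> (norm (x - a))\<^sup>2"
      by (simp add: \<phi>_def flat_exp_def power2_norm_eq_inner not_le)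
    also have "\<dots> \<longleftrightarrow> \<not> r \<le> norm (x - a)"
      using r(1) by simp
    finally show ?thesis
      by (simp add: dist_norm norm_minus_commute not_le)
  qed
  have "smooth \<phi>"
    unfolding \<phi>_def smooth_def
    by (auto intro!: C_k_flat_exp_compose simp: smooth_def C_k_quadratic)
  moreover have "closure {x. \<phi> x \<noteq> 0} = cball a r"
  proof -
    have "{x. \<phi> x \<noteq> 0} = ball a r" using nonzero by blast
    then show ?thesis using r(1) by simp
  qed
  ultimately have "\<phi> \<in> test_functions \<Omega>"
    using r(2) by (simp add: test_functions_def del: compact_closure)
  then show thesis
    using that[of \<phi> r] r nonzero by (meson ball_subset_cball order_trans)
qed

section \<open>Integration by parts\<close>

text \<open>
  The difference quotients of \<open>f\<close> in the direction \<open>e\<close> have integral zero, since Lebesgue measure is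
  translation invariant. By the mean value theorem a bound of the derivative on \<open>K\<close> bounds them,
  and for steps of length at most one they live on a common ball; so dominated convergence
  passes to the limit.
\<close>

lemma integral_directional_derivative_eq_0:
  fixes f :: "'a::euclidean_space \<Rightarrow> real"
  assumes deriv: "\<And>x. (f has_derivative D x) (at x)"
    and cont: "continuous_on UNIV (\<lambda>x. D x e)"
    and "compact K" and outside: "\<And>x. x \<notin> K \<Longrightarrow> f x = 0"
  shows "(LINT x|lborel. D x e) = 0"
proof -
  have D_outside: "D x e = 0" if "x \<notin> K" for x
  proof -
    have "(f has_derivative (\<lambda>_. 0)) (at x)"
      by (rule has_derivative_transform_within_open[OF has_derivative_const[of 0], of "- K"])
         (use \<open>compact K\<close> that outside in \<open>auto simp: compact_imp_closed\<close>)
    from has_derivative_unique[OF deriv this] show ?thesis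
      by simp
  qed
  have "compact ((\<lambda>x. D x e) ` K)"
    by (rule compact_continuous_image[OF continuous_on_subset[OF cont subset_UNIV] \<open>compact K\<close>])
  then obtain B where "B > 0" and "\<forall>x\<in>K. \<bar>D x e\<bar> \<le> B"
    by (auto dest!: compact_imp_bounded simp: bounded_pos)
  then have B: "\<bar>D x e\<bar> \<le> B" for x
    using D_outside[of x] by (cases "x \<in> K") simp_all
  obtain R where R: "\<forall>x\<in>K. norm x \<le> R"
    using compact_imp_bounded[OF \<open>compact K\<close>] unfolding bounded_iff by blast
  have line: "((\<lambda>t. f (x + t *\<^sub>R e)) has_real_derivative D (x + t *\<^sub>R e) e) (at t)" for x t
  proof -
    have "linear (D (x + t *\<^sub>R e))"
      using deriv has_derivative_linear by blast
    moreover have "((\<lambda>t. f (x + t *\<^sub>R e)) has_derivative (\<lambda>h. D (x + t *\<^sub>R e) (h *\<^sub>R e))) (at t)"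
      by (rule has_derivative_compose[of "\<lambda>t. x + t *\<^sub>R e" _ t UNIV f, OF _ deriv])
         (auto intro!: derivative_eq_intros)
    ultimately show ?thesis
      by (simp add: has_field_derivative_def linear_cmul mult.commute[of _ "D _ _"])
  qed
  define h where "h n = inverse (real (Suc n))" for n
  have h: "0 < h n" "h n \<le> 1" for n
    by (auto simp: h_def inverse_le_1_iff)
  define Q where "Q n x = (f (x + h n *\<^sub>R e) - f x) / h n" for n x
  have f_cont: "continuous_on UNIV f"
    by (intro continuous_at_imp_continuous_on ballI has_derivative_continuous[OF deriv])
  have f_int: "integrable lborel f"
  proof -
    have "integrable lborel (\<lambda>x. indicator K x *\<^sub>R f x)"
      by (rule borel_integrable_compact[OF \<open>compact K\<close> continuous_on_subset[OF f_cont subset_UNIV]])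
    moreover have "(\<lambda>x. indicator K x *\<^sub>R f x) = f"
      using outside by (auto simp: indicator_def fun_eq_iff)
    ultimately show ?thesis by simp
  qed
  have [measurable]: "f \<in> borel_measurable borel" "(\<lambda>x. D x e) \<in> borel_measurable borel"
    by (rule borel_measurable_continuous_onI, fact)+
  have Q_integral: "(LINT x|lborel. Q n x) = 0" for n
  proof -
    let ?c = "h n *\<^sub>R e"
    have "integrable (distr lborel borel ((+) ?c)) f"
      using f_int by (simp add: lborel_distr_plus)
    then have "integrable lborel (\<lambda>x. f (?c + x))"
      by (subst (asm) integrable_distr_eq) auto
    moreover have "(LINT x|lborel. f (?c + x)) = (LINT x|distr lborel borel ((+) ?c). f x)"
      by (subst integral_distr) auto
    ultimately show ?thesis
      using f_int by (simp add: Q_def lborel_distr_plus add.commute)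
  qed
  have "(\<lambda>n. LINT x|lborel. Q n x) \<longlonglongrightarrow> (LINT x|lborel. D x e)"
  proof (rule integral_dominated_convergence)
    show "integrable lborel (\<lambda>x. indicator (cball 0 (R + norm e)) x *\<^sub>R B)"
      by (rule borel_integrable_compact) auto
    show "AE x in lborel. (\<lambda>n. Q n x) \<longlonglongrightarrow> D x e"
    proof (rule AE_I2)
      fix x
      have "((\<lambda>t. (f (x + t *\<^sub>R e) - f x) / t) \<longlongrightarrow> D x e) (at 0)"
        using line[of x 0] by (simp add: DERIV_def)
      moreover have "filterlim h (at 0) sequentially"
        using h(1) LIMSEQ_inverse_real_of_nat
        by (auto simp: filterlim_at h_def[abs_def] simp del: of_nat_Suc)
      ultimately show "(\<lambda>n. Q n x) \<longlonglongrightarrow> D x e"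
        unfolding Q_def by (rule filterlim_compose)
    qed
    show "AE x in lborel. norm (Q n x) \<le> indicator (cball 0 (R + norm e)) x *\<^sub>R B" for n
    proof (rule AE_I2)
      fix x
      obtain z where "f (x + h n *\<^sub>R e) - f (x + 0 *\<^sub>R e) = (h n - 0) * D (x + z *\<^sub>R e) e"
        using MVT2[OF h(1) line] by blast
      then have "norm (Q n x) \<le> B"
        using B h(1)[of n] by (simp add: Q_def)
      moreover have "Q n x = 0" if "x \<notin> cball 0 (R + norm e)"
      proof -
        have "norm (h n *\<^sub>R e) \<le> norm e"
          using h[of n] by (simp add: mult_left_le_one_le)
        then have "norm x \<le> norm (x + h n *\<^sub>R e) + norm e"
          using norm_triangle_ineq4[of "x + h n *\<^sub>R e" "h n *\<^sub>R e"] by simp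
        then have "\<not> norm x \<le> R" "\<not> norm (x + h n *\<^sub>R e) \<le> R"
          using that norm_ge_zero[of e] unfolding mem_cball_0 by linarith+
        then have "x \<notin> K" "x + h n *\<^sub>R e \<notin> K"
          using R by blast+
        then show ?thesis by (simp add: Q_def outside)
      qed
      ultimately show "norm (Q n x) \<le> indicator (cball 0 (R + norm e)) x *\<^sub>R B"
        by (cases "x \<in> cball 0 (R + norm e)") simp_all
    qed
  qed (simp_all add: Q_def[abs_def])
  then show ?thesis
    by (simp add: Q_integral LIMSEQ_const_iff)
qed

lemma gradient_inner_Basis:
  "i \<in> Basis \<Longrightarrow> gradient f x \<bullet> i = frechet_derivative f (at x) i"
  by (simp add: gradient_def inner_sum_left_Basis)

lemma test_functionD:
  assumes "\<phi> \<in> test_functions \<Omega>"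
  shows "(\<phi> has_derivative frechet_derivative \<phi> (at x)) (at x)"
    and "continuous_on UNIV \<phi>" and "continuous_on UNIV (gradient \<phi>)"
    and "i \<in> Basis \<Longrightarrow> continuous_on UNIV (\<lambda>x. frechet_derivative \<phi> (at x) i)"
proof -
  have C_1: "C_k (Suc 0) \<phi>" and C_0: "C_k 0 \<phi>"
    using assms unfolding test_functions_def smooth_def by blast+
  show "(\<phi> has_derivative frechet_derivative \<phi> (at x)) (at x)"
    using C_1 frechet_derivative_works by auto
  show "continuous_on UNIV \<phi>"
    using C_0 by simp
  have partial: "continuous_on UNIV (\<lambda>x. frechet_derivative \<phi> (at x) i)" if "i \<in> Basis" for i
    using C_1 that by simp
  then show "i \<in> Basis \<Longrightarrow> continuous_on UNIV (\<lambda>x. frechet_derivative \<phi> (at x) i)" .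
  show "continuous_on UNIV (gradient \<phi>)"
    unfolding gradient_def[abs_def]
    by (intro continuous_on_sum continuous_on_scaleR continuous_on_const partial)
qed

lemma eq_0_outside_support:
  assumes "x \<notin> closure {x. \<phi> x \<noteq> 0}"
  shows "\<phi> x = 0" "gradient \<phi> x = 0"
proof -
  define U where "U = - closure {x. \<phi> x \<noteq> 0}"
  have U: "open U" "x \<in> U"
    using assms by (simp_all add: U_def open_Compl)
  have zero: "\<phi> y = 0" if "y \<in> U" for y
    using that closure_subset[of "{x. \<phi> x \<noteq> 0}"] unfolding U_def by blast
  show "\<phi> x = 0"
    using U(2) by (rule zero)
  have "(\<phi> has_derivative (\<lambda>_. 0)) (at x)"
    by (rule has_derivative_transform_within_open[OF has_derivative_const[of 0] U])
      (simp add: zero)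
  from frechet_derivative_at[OF this] have "frechet_derivative \<phi> (at x) = (\<lambda>_. 0)"
    by (rule sym)
  then show "gradient \<phi> x = 0"
    by (simp add: gradient_def)
qed

lemma integrable_continuous_bounded:
  fixes f :: "'a::euclidean_space \<Rightarrow> 'b::euclidean_space"
  assumes cont: "continuous_on UNIV f" and S: "S \<in> sets lebesgue" "bounded S"
  shows "integrable (lebesgue_on S) f"
proof -
  interpret finite_measure "lebesgue_on S"
    using S by (intro finite_measure_lebesgue_on bounded_set_imp_lmeasurable)
  have "compact (f ` closure S)"
    using S cont by (meson compact_closure compact_continuous_image continuous_on_subset subset_UNIV)
  then obtain B where "\<And>x. x \<in> closure S \<Longrightarrow> norm (f x) \<le> B"
    by (metis bounded_iff compact_imp_bounded imageI)
  then have "AE x in lebesgue_on S. norm (f x) \<le> B"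
    using closure_subset by (intro AE_I2) auto
  then show ?thesis
    using cont S continuous_on_subset
    by (intro integrable_const_bound continuous_imp_measurable_on_sets_lebesgue) blast+
qed

lemma continuous_in_Lp_space:
  fixes f :: "'a::euclidean_space \<Rightarrow> 'b::euclidean_space"
  assumes "continuous_on UNIV f" "S \<in> sets lebesgue" "bounded S" "p > 0"
  shows "f \<in> Lp_space p S"
proof -
  have "continuous_on UNIV (\<lambda>x. norm (f x) powr p)"
    using assms by (intro continuous_on_powr' continuous_intros) auto
  then show ?thesis
    using assms integrable_continuous_bounded[of f S] integrable_continuous_bounded[of "\<lambda>x. norm (f x) powr p" S]
    unfolding Lp_space_def by auto
qed

lemma continuous_locally_integrable:
  fixes f :: "'a::euclidean_space \<Rightarrow> 'b::euclidean_space"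
  shows "continuous_on UNIV f \<Longrightarrow> locally_integrable \<Omega> f"
  unfolding locally_integrable_def
  using integrable_continuous_bounded[of f]
  by (meson compact_imp_bounded fmeasurableD lmeasurable_compact)

text \<open>
  The two sides of the identity differ by the integral of the partial derivative of the product
  \<open>\<phi> * \<psi>\<close>. Its support lies in \<open>\<Omega>\<close>, so that the integral can be taken over the whole space,
  where it vanishes.
\<close>

lemma test_function_has_weak_gradient:
  fixes \<Omega> :: "'a::euclidean_space set"
  assumes \<phi>: "\<phi> \<in> test_functions \<Omega>" and "open \<Omega>" "bounded \<Omega>"
  shows "has_weak_gradient \<Omega> \<phi> (gradient \<phi>)"
proof -
  have by_parts: "(LINT x|lebesgue_on \<Omega>. \<phi> x * (gradient \<psi> x \<bullet> i)) =
        - (LINT x|lebesgue_on \<Omega>. (gradient \<phi> x \<bullet> i) * \<psi> x)"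
    if \<psi>: "\<psi> \<in> test_functions \<Omega>" and i: "i \<in> Basis" for \<psi> i
  proof -
    define K where "K = closure {x. \<psi> x \<noteq> 0}"
    have K: "compact K" "K \<subseteq> \<Omega>"
      using \<psi> unfolding test_functions_def K_def by blast+
    have \<Omega>: "\<Omega> \<in> sets lebesgue"
      using \<open>open \<Omega>\<close> by (simp add: borel_open)
    define D where "D x h = \<phi> x * frechet_derivative \<psi> (at x) h
      + frechet_derivative \<phi> (at x) h * \<psi> x" for x h
    note conts = test_functionD(2)[OF \<phi>] test_functionD(2)[OF \<psi>]
      test_functionD(4)[OF \<phi> i] test_functionD(4)[OF \<psi> i]
    have D_cont: "continuous_on UNIV (\<lambda>x. D x i)"
      unfolding D_def by (intro continuous_intros conts)
    have D_outside: "D x i = 0" if "x \<notin> \<Omega>" for x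
    proof -
      have "x \<notin> closure {x. \<psi> x \<noteq> 0}"
        using K(2) that unfolding K_def by blast
      from eq_0_outside_support[OF this] show ?thesis
        unfolding D_def gradient_inner_Basis[OF i, symmetric] by simp
    qed
    have "(LINT x|lebesgue_on \<Omega>. \<phi> x * (gradient \<psi> x \<bullet> i)) +
          (LINT x|lebesgue_on \<Omega>. (gradient \<phi> x \<bullet> i) * \<psi> x) = (LINT x|lebesgue_on \<Omega>. D x i)"
      unfolding D_def gradient_inner_Basis[OF i]
      by (rule Bochner_Integration.integral_add[symmetric];
          intro integrable_continuous_bounded continuous_on_mult conts \<Omega> \<open>bounded \<Omega>\<close>)
    also have "\<dots> = (LINT x|lebesgue. (if x \<in> \<Omega> then D x i else 0))"
      using \<Omega> by (rule Lebesgue_Measure.integral_restrict_UNIV[symmetric])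
    also have "\<dots> = (LINT x|lebesgue. D x i)"
      using D_outside by (intro Bochner_Integration.integral_cong) auto
    also have "\<dots> = (LINT x|lborel. D x i)"
      using D_cont by (intro integral_completion) (simp add: borel_measurable_continuous_onI)
    also have "\<dots> = 0"
    proof (rule integral_directional_derivative_eq_0[where f = "\<lambda>x. \<phi> x * \<psi> x" and K = K])
      show "((\<lambda>x. \<phi> x * \<psi> x) has_derivative D x) (at x)" for x
        unfolding D_def by (intro has_derivative_mult test_functionD(1)[OF \<phi>] test_functionD(1)[OF \<psi>])
      show "\<phi> x * \<psi> x = 0" if "x \<notin> K" for x
        using eq_0_outside_support(1)[of x \<psi>] that unfolding K_def by auto
    qed (use K D_cont in auto)
    finally show ?thesis by simp
  qed
  show ?thesis
    unfolding has_weak_gradient_def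
  proof (intro conjI ballI)
    show "locally_integrable \<Omega> \<phi>" "locally_integrable \<Omega> (gradient \<phi>)"
      by (rule continuous_locally_integrable, rule test_functionD[OF \<phi>])+
  qed (rule by_parts)
qed

section \<open>Existence of an admissible pair\<close>

lemma test_function_in_W0:
  fixes \<Omega> :: "'a::euclidean_space set"
  assumes "\<phi> \<in> test_functions \<Omega>" "open \<Omega>" "bounded \<Omega>" "p > 0"
  shows "\<phi> \<in> W0 p \<Omega>"
proof -
  have "\<Omega> \<in> sets lebesgue"
    using \<open>open \<Omega>\<close> by (simp add: borel_open)
  then have "\<phi> \<in> Lp_space p \<Omega>" "gradient \<phi> \<in> Lp_space p \<Omega>"
    using assms test_functionD(2,3)[OF assms(1)] by (auto intro: continuous_in_Lp_space)
  moreover have "\<exists>\<phi>'. (\<forall>n::nat. \<phi>' n \<in> test_functions \<Omega>) \<and>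
      (\<lambda>n. Lp_norm p \<Omega> (\<lambda>x. \<phi>' n x - \<phi> x)) \<longlonglongrightarrow> 0 \<and>
      (\<lambda>n. Lp_norm p \<Omega> (\<lambda>x. gradient (\<phi>' n) x - gradient \<phi> x)) \<longlonglongrightarrow> 0"
    by (rule exI[of _ "\<lambda>_. \<phi>"]) (use assms in \<open>simp add: Lp_norm_def\<close>)
  ultimately show ?thesis
    using test_function_has_weak_gradient[OF assms(1-3)] unfolding W0_def by blast
qed

lemma admissible_nonempty:
  fixes \<Omega> :: "'a::euclidean_space set"
  assumes "open \<Omega>" "bounded \<Omega>" "\<Omega> \<noteq> {}" "p > 0" "q > 0" "\<alpha> + \<beta> > 0"
  shows "\<exists>u v. (u, v) \<in> admissible \<Omega> \<alpha> \<beta> p q"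
proof -
  obtain a where "a \<in> \<Omega>" using \<open>\<Omega> \<noteq> {}\<close> by blast
  then obtain \<phi> r where \<phi>: "\<phi> \<in> test_functions \<Omega>" and r: "r > 0" "ball a r \<subseteq> \<Omega>"
    and nonzero: "\<And>x. x \<in> ball a r \<Longrightarrow> \<phi> x \<noteq> 0"
    using test_function_exists \<open>open \<Omega>\<close> by metis
  have \<Omega>: "\<Omega> \<in> sets lebesgue"
    using \<open>open \<Omega>\<close> by (simp add: borel_open)
  define g where "g x = \<bar>\<phi> x\<bar> powr (\<alpha> + \<beta>)" for x
  have g_eq: "\<bar>\<phi> x\<bar> powr (\<alpha> - 1) * \<bar>\<phi> x\<bar> powr (\<beta> - 1) * \<phi> x * \<phi> x = g x" for x
    by (cases "\<phi> x = 0") (simp_all add: g_def powr_diff powr_add)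
  have "continuous_on UNIV g"
    unfolding g_def using test_functionD(2)[OF \<phi>] assms
    by (intro continuous_on_powr' continuous_intros) auto
  then have g_int: "integrable (lebesgue_on \<Omega>) g"
    using \<Omega> \<open>bounded \<Omega>\<close> by (rule integrable_continuous_bounded)
  have "\<not> (AE x in lebesgue_on \<Omega>. g x = 0)"
  proof
    assume "AE x in lebesgue_on \<Omega>. g x = 0"
    then have "AE x in lebesgue. x \<in> \<Omega> \<longrightarrow> g x = 0"
      using \<Omega> by (simp add: AE_restrict_space_iff)
    then have "AE x in lebesgue. x \<notin> ball a r"
      by eventually_elim (use nonzero r in \<open>auto simp: g_def\<close>)
    then have "ball a r \<in> null_sets lebesgue"
      by (subst (asm) AE_iff_null_sets[symmetric]) auto
    then show False
      using r(1) open_not_negligible[of "ball a r"] by (simp add: negligible_iff_null_sets)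
  qed
  moreover have g_nonneg: "g x \<ge> 0" for x
    by (simp add: g_def)
  ultimately have "(LINT x|lebesgue_on \<Omega>. g x) \<noteq> 0"
    using integral_nonneg_eq_0_iff_AE[OF g_int] by simp
  moreover have "(LINT x|lebesgue_on \<Omega>. g x) \<ge> 0"
    by (intro Bochner_Integration.integral_nonneg g_nonneg)
  ultimately have "coupling \<Omega> \<alpha> \<beta> \<phi> \<phi> > 0"
    by (simp add: coupling_def g_eq)
  then have "(\<phi>, \<phi>) \<in> admissible \<Omega> \<alpha> \<beta> p q"
    using test_function_in_W0[OF \<phi>] assms by (simp add: admissible_def)
  then show ?thesis by blast
qed

section \<open>Comparison of the eigenvalues\<close>

lemma W0_integrable:
  "u \<in> W0 r \<Omega> \<Longrightarrow> integrable (lebesgue_on \<Omega>) (\<lambda>x. \<bar>u x\<bar> powr r)"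
  by (simp add: W0_def Lp_space_def)

lemma first_eigenvalue_mult_le:
  assumes "u \<in> W0 r \<Omega>" and nonzero: "\<not> (AE x in lebesgue_on \<Omega>. u x = 0)"
  shows "first_eigenvalue \<Omega> r * (LINT x|lebesgue_on \<Omega>. \<bar>u x\<bar> powr r)
    \<le> (LINT x|lebesgue_on \<Omega>. norm (weak_gradient \<Omega> u x) powr r)"
proof -
  have "integrable (lebesgue_on \<Omega>) (\<lambda>x. \<bar>u x\<bar> powr r)"
    using assms(1) by (rule W0_integrable)
  then have "(LINT x|lebesgue_on \<Omega>. \<bar>u x\<bar> powr r) \<noteq> 0"
    using nonzero by (subst integral_nonneg_eq_0_iff_AE) auto
  then have pos: "(LINT x|lebesgue_on \<Omega>. \<bar>u x\<bar> powr r) > 0"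
    by (simp add: order_less_le)
  have "first_eigenvalue \<Omega> r \<le> (LINT x|lebesgue_on \<Omega>. norm (weak_gradient \<Omega> u x) powr r) /
     (LINT x|lebesgue_on \<Omega>. \<bar>u x\<bar> powr r)"
    unfolding first_eigenvalue_def
  proof (rule cInf_lower)
    show "bdd_below {
       (LINT x|lebesgue_on \<Omega>. norm (weak_gradient \<Omega> u x) powr r) /
       (LINT x|lebesgue_on \<Omega>. \<bar>u x\<bar> powr r)
       | u. u \<in> W0 r \<Omega> \<and> \<not> (AE x in lebesgue_on \<Omega>. u x = 0)}"
      by (rule bdd_belowI[of _ 0]) (auto intro!: divide_nonneg_nonneg)
  qed (use assms in blast)
  then show ?thesis
    using pos by (simp add: pos_le_divide_eq)
qed

text \<open>The nonzero function guarantees that the infimum is not that of the empty set.\<close>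

lemma first_eigenvalue_nonneg:
  assumes "u \<in> W0 r \<Omega>" "\<not> (AE x in lebesgue_on \<Omega>. u x = 0)"
  shows "first_eigenvalue \<Omega> r \<ge> 0"
  unfolding first_eigenvalue_def
  by (rule cInf_greatest) (use assms in \<open>auto intro!: divide_nonneg_nonneg\<close>)

text \<open>
  The weighted arithmetic-geometric mean inequality for \<open>|u|\<^sup>p\<close> and \<open>|v|\<^sup>q\<close>, whose weighted
  geometric mean is \<open>|u|\<^sup>\<alpha> |v|\<^sup>\<beta>\<close>.
\<close>

lemma powr_Youngs_inequality:
  fixes u v p q \<alpha> \<beta> :: real
  assumes "p > 0" "q > 0" "\<alpha> \<ge> 0" "\<beta> \<ge> 0" "\<alpha> / p + \<beta> / q = 1"
  shows "\<bar>u\<bar> powr (\<alpha> - 1) * \<bar>v\<bar> powr (\<beta> - 1) * u * v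
    \<le> \<alpha> / p * \<bar>u\<bar> powr p + \<beta> / q * \<bar>v\<bar> powr q"
proof (cases "u = 0 \<or> v = 0")
  case True
  then show ?thesis using assms by auto
next
  case False
  have "\<bar>u\<bar> powr (\<alpha> - 1) * \<bar>v\<bar> powr (\<beta> - 1) * u * v
      \<le> \<bar>\<bar>u\<bar> powr (\<alpha> - 1) * \<bar>v\<bar> powr (\<beta> - 1) * u * v\<bar>"
    by (rule abs_ge_self)
  also have "\<dots> = (\<bar>u\<bar> powr p) powr (\<alpha> / p) * (\<bar>v\<bar> powr q) powr (\<beta> / q)"
    using False assms by (simp add: abs_mult powr_diff powr_powr)
  also have "\<dots> \<le> \<alpha> / p * \<bar>u\<bar> powr p + \<beta> / q * \<bar>v\<bar> powr q"
    using False assms by (intro Youngs_inequality_0) auto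
  finally show ?thesis .
qed

lemma coupling_le:
  assumes "u \<in> W0 p \<Omega>" "v \<in> W0 q \<Omega>" and pos: "coupling \<Omega> \<alpha> \<beta> u v > 0"
    and "p > 0" "q > 0" "\<alpha> \<ge> 0" "\<beta> \<ge> 0" "\<alpha> / p + \<beta> / q = 1"
  shows "coupling \<Omega> \<alpha> \<beta> u v \<le> \<alpha> / p * (LINT x|lebesgue_on \<Omega>. \<bar>u x\<bar> powr p)
    + \<beta> / q * (LINT x|lebesgue_on \<Omega>. \<bar>v x\<bar> powr q)"
proof -
  have [simp]: "integrable (lebesgue_on \<Omega>) (\<lambda>x. \<bar>u x\<bar> powr p)"
    "integrable (lebesgue_on \<Omega>) (\<lambda>x. \<bar>v x\<bar> powr q)"
    by (rule W0_integrable, fact)+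
  have "coupling \<Omega> \<alpha> \<beta> u v
      \<le> (LINT x|lebesgue_on \<Omega>. \<alpha> / p * \<bar>u x\<bar> powr p + \<beta> / q * \<bar>v x\<bar> powr q)"
    unfolding coupling_def
  proof (rule integral_mono)
    \<comment> \<open>The integral of a non-integrable function is zero by convention, not positive.\<close>
    show "integrable (lebesgue_on \<Omega>) (\<lambda>x. \<bar>u x\<bar> powr (\<alpha> - 1) * \<bar>v x\<bar> powr (\<beta> - 1) * u x * v x)"
      by (rule ccontr) (use pos not_integrable_integral_eq in \<open>force simp: coupling_def\<close>)
    show "integrable (lebesgue_on \<Omega>) (\<lambda>x. \<alpha> / p * \<bar>u x\<bar> powr p + \<beta> / q * \<bar>v x\<bar> powr q)"
      by simp
  qed (rule powr_Youngs_inequality[OF assms(4-8)])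
  then show ?thesis by simp
qed

lemma coupling_pos_imp_nonzero:
  assumes "coupling \<Omega> \<alpha> \<beta> u v > 0"
  shows "\<not> (AE x in lebesgue_on \<Omega>. u x = 0)" "\<not> (AE x in lebesgue_on \<Omega>. v x = 0)"
proof -
  have *: False if "AE x in lebesgue_on \<Omega>. u x = 0 \<or> v x = 0"
  proof -
    have "coupling \<Omega> \<alpha> \<beta> u v = 0"
      unfolding coupling_def by (rule integral_eq_zero_AE) (use that in eventually_elim, auto)
    then show False using assms by simp
  qed
  show "\<not> (AE x in lebesgue_on \<Omega>. u x = 0)" "\<not> (AE x in lebesgue_on \<Omega>. v x = 0)"
    by (auto intro!: * elim: eventually_mono)
qed

theorem theorem3p3:
  fixes \<Omega> :: "'a::euclidean_space set" and p q \<alpha> \<beta> :: real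
  assumes "smooth_bounded_domain \<Omega>"
    and "p > 1" and "q > 1" and "\<alpha> \<ge> 1" and "\<beta> \<ge> 1"
    and "\<alpha> / p + \<beta> / q = 1"
  shows "system_eigenvalue \<Omega> \<alpha> \<beta> p q \<ge> min (first_eigenvalue \<Omega> p) (first_eigenvalue \<Omega> q)"
  unfolding system_eigenvalue_def
proof (rule cInf_greatest)
  show "{(\<alpha> / p * (LINT x|lebesgue_on \<Omega>. norm (weak_gradient \<Omega> u x) powr p) +
      \<beta> / q * (LINT x|lebesgue_on \<Omega>. norm (weak_gradient \<Omega> v x) powr q)) /
     coupling \<Omega> \<alpha> \<beta> u v | u v. (u, v) \<in> admissible \<Omega> \<alpha> \<beta> p q} \<noteq> {}"
    using admissible_nonempty[of \<Omega> p q \<alpha> \<beta>] assms by (auto simp: smooth_bounded_domain_def)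
next
  fix z
  let ?m = "min (first_eigenvalue \<Omega> p) (first_eigenvalue \<Omega> q)"
  assume "z \<in> {(\<alpha> / p * (LINT x|lebesgue_on \<Omega>. norm (weak_gradient \<Omega> u x) powr p) +
      \<beta> / q * (LINT x|lebesgue_on \<Omega>. norm (weak_gradient \<Omega> v x) powr q)) /
     coupling \<Omega> \<alpha> \<beta> u v | u v. (u, v) \<in> admissible \<Omega> \<alpha> \<beta> p q}"
  then obtain u v where uv: "u \<in> W0 p \<Omega>" "v \<in> W0 q \<Omega>" and pos: "coupling \<Omega> \<alpha> \<beta> u v > 0"
    and z: "z = (\<alpha> / p * (LINT x|lebesgue_on \<Omega>. norm (weak_gradient \<Omega> u x) powr p) +
      \<beta> / q * (LINT x|lebesgue_on \<Omega>. norm (weak_gradient \<Omega> v x) powr q)) /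
     coupling \<Omega> \<alpha> \<beta> u v"
    by (auto simp: admissible_def)
  note nonzero = coupling_pos_imp_nonzero[OF pos]
  have m: "0 \<le> ?m"
    using first_eigenvalue_nonneg uv nonzero by (metis min_def)
  have weighted: "?m * I \<le> G" if "c * I \<le> G" "?m \<le> c" "I \<ge> 0" for c I G :: real
    using that by (meson mult_right_mono order_trans)
  have "?m * coupling \<Omega> \<alpha> \<beta> u v \<le> ?m * (\<alpha> / p * (LINT x|lebesgue_on \<Omega>. \<bar>u x\<bar> powr p)
      + \<beta> / q * (LINT x|lebesgue_on \<Omega>. \<bar>v x\<bar> powr q))"
    using assms m by (intro mult_left_mono coupling_le uv pos) auto
  also have "\<dots> = \<alpha> / p * (?m * (LINT x|lebesgue_on \<Omega>. \<bar>u x\<bar> powr p))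
      + \<beta> / q * (?m * (LINT x|lebesgue_on \<Omega>. \<bar>v x\<bar> powr q))"
    by (simp only: distrib_left mult.left_commute)
  also have "\<dots> \<le> \<alpha> / p * (LINT x|lebesgue_on \<Omega>. norm (weak_gradient \<Omega> u x) powr p) +
      \<beta> / q * (LINT x|lebesgue_on \<Omega>. norm (weak_gradient \<Omega> v x) powr q)"
    using assms
    by (intro add_mono mult_left_mono
        weighted[OF first_eigenvalue_mult_le[OF uv(1) nonzero(1)]]
        weighted[OF first_eigenvalue_mult_le[OF uv(2) nonzero(2)]]) auto
  finally show "?m \<le> z"
    using pos by (simp add: z pos_le_divide_eq)
qed

end
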